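(* For each contract $(l,t)$ let $L_{k,l,t}$ be the lowest end-point of (the support of) the marginal distribution of the utility $U_{k,l,t}$. Consider the pricing strategy $$p_{k,l,t}=v_{l,t}-v_{-k}+\Big(\max_{i,j}\{L_{k,i,j}-v_{i,j}+v_{-k}\}\Big)^{+}\qquad (l\in\{1,\dots,L\},\ t\in\{t_k+1,\dots,T\}),$$ where $x^+=\max\{x,0\}$. This pricing strategy maximizes the ex-post social welfare: for every possible realization $(u_{k,l,t})_{l,t}$ of $(U_{k,l,t})_{l,t}$ it maximizes $\sum_{l,t}(u_{k,l,t}-v_{l,t}+v_{-k})A_{k,l,t}(\mathbf p_k)$ over all price menus $\mathbf p_k=(p_{k,l,t})_{l,t}$ with $p_{k,l,t}\ge0$. The profit of the charging station under this strategy is $$\Big(\max_{i,j}\{L_{k,i,j}-v_{i,j}+v_{-k}\}\Big)^{+}.$$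
   Context: Contracts and user. User $k$ arrives at a charging station at time $t_k<T$ (discrete time, horizon $T$). A contract is a pair $(l,t)$ with energy level $l\in\{1,\dots,L\}$ and deadline $t\in\{t_k+1,\dots,T\}$. The station posts a price $p_{k,l,t}\ge 0$ for every contract; $\mathbf p_k=(p_{k,l,t})_{l,t}$ (the value $+\infty$ is allowed; a contract with infinite price is never accepted, and its terms in all sums are read as $0$). User $k$ has real utility $u_{k,l,t}$ for contract $(l,t)$, the realization of a random variable $U_{k,l,t}$ (the $U_{k,l,t}$ have some joint distribution, not necessarily independent; every possible realization satisfies $u_{k,l,t}\ge L_{k,l,t}$), and utility $0$ if it rejects all contracts. The user knows its realized utilities; the station does not. Given $\mathbf p_k$ the user is a price taker and chooses $A_{k,l,t}(\mathbf p_k)\in[0,1]$ to maximize $\sum_{l,t}A_{k,l,t}(u_{k,l,t}-p_{k,l,t})$ subject to $\sum_{l,t}A_{k,l,t}\le 1$: it chooses a contract (or any convex combination of contracts) attaining the maximal payoff $\max_{i,j}(u_{k,i,j}-p_{k,i,j})$ if this maximum is $\ge 0$ (ties between charging and not charging are resolved in favour of charging, so then $\sum_{l,t} A_{k,l,t}=1$), and all $A_{k,l,t}=0$ if the maximum is negative. Costs. $\mathcal K_0$ is the set of users already present at time $t_k$; user $i\in\mathcal K_0$ has deadline $w_i$ and remaining demand $N_i$. Known data: conventional energy prices $c_t\ge0$, harvested energies $\bar E^t\ge 0$, maximal charging rate $R_{max}$, battery capacity $B_{max}$, initial battery level $B_0\in[0,B_{max}]$. For a contract $(l,d)$, $v_{l,d}$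 is the optimal value of the linear program: minimize $\sum_{t=t_k}^{T-1}c_tq_t$ over nonnegative variables $r_{k,t},q_{k,t},r_{i,t},q_{i,t}\ (i\in\mathcal K_0),\,q_t,r_t,D_t$ (for $t_k\le t\le T-1$) and battery levels $B^t$, subject to (a) $\sum_{t=t_k}^{d-1}(r_{k,t}+q_{k,t})\ge l$; (b) $\sum_{t=t_k}^{w_i-1}(r_{i,t}+q_{i,t})\ge N_i$ for all $i\in\mathcal K_0$; (c) $r_{k,t}+q_{k,t}\le R_{max}$ and $r_{i,t}+q_{i,t}\le R_{max}$ for all $i\in\mathcal K_0$ and all $t$; (d) $r_{k,t}+\sum_{i\in\mathcal K_0}r_{i,t}=r_t$ and $q_{k,t}+\sum_{i\in\mathcal K_0}q_{i,t}\le q_t$ for all $t$; (e) $B^{t+1}=B^t+\bar E^t-r_t+q_t-q_{k,t}-\sum_{i\in\mathcal K_0}q_{i,t}-D_t$, $0\le B^{t+1}\le B_{max}$, $B^{t_k}=B_0$, $B^T=B_0$. If the program is infeasible, $v_{l,d}=\infty$. $v_{-k}$ is the optimal value of the same program with $r_{k,t}=q_{k,t}=0$ for all $t$ and constraint (a) dropped (the cost of serving only the existing users), assumed finite. These costs do not depend on the prices, and $v_{l,t}-v_{-k}\ge 0$. The profit of the station is $\sum_{l,t}(p_{k,l,t}-v_{l,t}+v_{-k})A_{k,l,t}(\mathbf p_k)$, and the social welfare (user surplus plus profit) is $\sum_{l,t}(u_{k,l,t}-v_{l,t}+v_{-k})A_{k,l,t}(\mathbf p_k)$. *)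

theory Defs
  imports "HOL-Probability.Probability"
begin

record 'i station =
  arrival :: nat               \<comment> \<open>\<open>t\<^sub>k\<close>\<close>
  horizon :: nat               \<comment> \<open>\<open>T\<close>\<close>
  levels :: nat                \<comment> \<open>\<open>L\<close>\<close>
  present :: "'i set"          \<comment> \<open>\<open>K\<^sub>0\<close>\<close>
  deadline :: "'i \<Rightarrow> nat"      \<comment> \<open>\<open>w\<^sub>i\<close>\<close>
  demand :: "'i \<Rightarrow> real"       \<comment> \<open>\<open>N\<^sub>i\<close>\<close>
  price :: "nat \<Rightarrow> real"       \<comment> \<open>\<open>c\<^sub>t\<close>\<close>
  harvest :: "nat \<Rightarrow> real"
  max_rate :: real             \<comment> \<open>\<open>R\<^sub>m\<^sub>a\<^sub>x\<close>\<close>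
  max_battery :: real          \<comment> \<open>\<open>B\<^sub>m\<^sub>a\<^sub>x\<close>\<close>
  init_battery :: real         \<comment> \<open>\<open>B\<^sub>0\<close>\<close>

definition valid_station :: "'i station \<Rightarrow> bool" where
  "valid_station S \<longleftrightarrow>
     arrival S < horizon S \<and> 1 \<le> levels S \<and> finite (present S) \<and>
     (\<forall>i\<in>present S. deadline S i \<le> horizon S) \<and>
     (\<forall>t\<in>{arrival S..<horizon S}. 0 \<le> price S t \<and> 0 \<le> harvest S t) \<and>
     0 \<le> init_battery S \<and> init_battery S \<le> max_battery S"

definition contracts :: "'i station \<Rightarrow> (nat \<times> nat) set" where
  "contracts S = {1..levels S} \<times> {arrival S + 1..horizon S}"

text \<open>
  The variables of the linear program: \<open>r\<close> stands for energy taken from the renewable side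
  (harvest and battery) and \<open>q\<close> for conventional energy; the suffix \<open>_new\<close> refers to the arriving
  user, \<open>_old\<close> to the users already present, and \<open>_tot\<close> to \<open>r\<^sub>t\<close>, \<open>q\<^sub>t\<close>.
\<close>

record 'i plan =
  r_new :: "nat \<Rightarrow> real"
  q_new :: "nat \<Rightarrow> real"
  r_old :: "'i \<Rightarrow> nat \<Rightarrow> real"
  q_old :: "'i \<Rightarrow> nat \<Rightarrow> real"
  r_tot :: "nat \<Rightarrow> real"
  q_tot :: "nat \<Rightarrow> real"
  discard :: "nat \<Rightarrow> real"     \<comment> \<open>\<open>D\<^sub>t\<close>\<close>
  battery :: "nat \<Rightarrow> real"

text \<open>The constraints common to both programs, i.e. all except the demand of the arriving user.\<close>

definition feasible_plan :: "'i station \<Rightarrow> 'i plan \<Rightarrow> bool" where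
  "feasible_plan S x \<longleftrightarrow>
     (\<forall>t\<in>{arrival S..<horizon S}.
        0 \<le> r_new x t \<and> 0 \<le> q_new x t \<and>
        (\<forall>i\<in>present S. 0 \<le> r_old x i t \<and> 0 \<le> q_old x i t) \<and>
        0 \<le> r_tot x t \<and> 0 \<le> q_tot x t \<and> 0 \<le> discard x t) \<and>
     (\<forall>i\<in>present S.
        (\<Sum>t = arrival S..<deadline S i. r_old x i t + q_old x i t) \<ge> demand S i) \<and>
     (\<forall>t\<in>{arrival S..<horizon S}.
        r_new x t + q_new x t \<le> max_rate S \<and>
        (\<forall>i\<in>present S. r_old x i t + q_old x i t \<le> max_rate S)) \<and>
     (\<forall>t\<in>{arrival S..<horizon S}.
        r_new x t + (\<Sum>i\<in>present S. r_old x i t) = r_tot x t \<and>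
        q_new x t + (\<Sum>i\<in>present S. q_old x i t) \<le> q_tot x t) \<and>
     (\<forall>t\<in>{arrival S..<horizon S}.
        battery x (t + 1) = battery x t + harvest S t - r_tot x t + q_tot x t
          - q_new x t - (\<Sum>i\<in>present S. q_old x i t) - discard x t \<and>
        0 \<le> battery x (t + 1) \<and> battery x (t + 1) \<le> max_battery S) \<and>
     battery x (arrival S) = init_battery S \<and> battery x (horizon S) = init_battery S"

definition plan_cost :: "'i station \<Rightarrow> 'i plan \<Rightarrow> real" where
  "plan_cost S x = (\<Sum>t = arrival S..<horizon S. price S t * q_tot x t)"

text \<open>Optimal values are infima in \<^typ>\<open>ereal\<close>, so that an infeasible program has value \<open>\<infinity>\<close>.\<close>

definition contract_cost :: "'i station \<Rightarrow> nat \<Rightarrow> nat \<Rightarrow> ereal" where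
  "contract_cost S l d =
     (INF x \<in> {x. feasible_plan S x \<and>
                  (\<Sum>t = arrival S..<d. r_new x t + q_new x t) \<ge> real l}. ereal (plan_cost S x))"

definition base_cost :: "'i station \<Rightarrow> ereal" where
  "base_cost S =
     (INF x \<in> {x. feasible_plan S x \<and>
                  (\<forall>t\<in>{arrival S..<horizon S}. r_new x t = 0 \<and> q_new x t = 0)}.
        ereal (plan_cost S x))"

definition price_menu :: "'i station \<Rightarrow> (nat \<Rightarrow> nat \<Rightarrow> ereal) \<Rightarrow> bool" where
  "price_menu S p \<longleftrightarrow> (\<forall>(l, t)\<in>contracts S. 0 \<le> p l t)"

definition admissible_choice ::
  "'i station \<Rightarrow> (nat \<Rightarrow> nat \<Rightarrow> ereal) \<Rightarrow> (nat \<Rightarrow> nat \<Rightarrow> real) \<Rightarrow> bool" where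
  "admissible_choice S p a \<longleftrightarrow>
     (\<forall>(l, t)\<in>contracts S. 0 \<le> a l t \<and> a l t \<le> 1 \<and> (p l t = \<infinity> \<longrightarrow> a l t = 0)) \<and>
     (\<Sum>(l, t)\<in>contracts S. a l t) \<le> 1"

text \<open>
  In \<^typ>\<open>ereal\<close> the product of \<open>0\<close> with anything is \<open>0\<close>. Hence in the three sums below the terms
  of contracts with infinite price, for which an admissible \<open>a\<close> is \<open>0\<close>, vanish.
\<close>

definition user_surplus ::
  "'i station \<Rightarrow> (nat \<Rightarrow> nat \<Rightarrow> real) \<Rightarrow> (nat \<Rightarrow> nat \<Rightarrow> ereal) \<Rightarrow> (nat \<Rightarrow> nat \<Rightarrow> real) \<Rightarrow> ereal" where
  "user_surplus S u p a = (\<Sum>(l, t)\<in>contracts S. ereal (a l t) * (ereal (u l t) - p l t))"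

definition profit ::
  "'i station \<Rightarrow> (nat \<Rightarrow> nat \<Rightarrow> ereal) \<Rightarrow> (nat \<Rightarrow> nat \<Rightarrow> real) \<Rightarrow> ereal" where
  "profit S p a =
     (\<Sum>(l, t)\<in>contracts S. (p l t - contract_cost S l t + base_cost S) * ereal (a l t))"

definition social_welfare ::
  "'i station \<Rightarrow> (nat \<Rightarrow> nat \<Rightarrow> real) \<Rightarrow> (nat \<Rightarrow> nat \<Rightarrow> real) \<Rightarrow> ereal" where
  "social_welfare S u a =
     (\<Sum>(l, t)\<in>contracts S. (ereal (u l t) - contract_cost S l t + base_cost S) * ereal (a l t))"

definition max_payoff ::
  "'i station \<Rightarrow> (nat \<Rightarrow> nat \<Rightarrow> real) \<Rightarrow> (nat \<Rightarrow> nat \<Rightarrow> ereal) \<Rightarrow> ereal" where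
  "max_payoff S u p = Max ((\<lambda>(l, t). ereal (u l t) - p l t) ` contracts S)"

text \<open>
  The last two conjuncts are the tie-breaking rule. Together with optimality they force \<open>a\<close> to be a
  convex combination of contracts of maximal payoff whenever that payoff is nonnegative.
\<close>

definition user_response ::
  "'i station \<Rightarrow> (nat \<Rightarrow> nat \<Rightarrow> real) \<Rightarrow> (nat \<Rightarrow> nat \<Rightarrow> ereal) \<Rightarrow> (nat \<Rightarrow> nat \<Rightarrow> real) \<Rightarrow> bool" where
  "user_response S u p a \<longleftrightarrow>
     admissible_choice S p a \<and>
     (\<forall>a'. admissible_choice S p a' \<longrightarrow> user_surplus S u p a' \<le> user_surplus S u p a) \<and>
     (max_payoff S u p \<ge> 0 \<longrightarrow> (\<Sum>(l, t)\<in>contracts S. a l t) = 1) \<and>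
     (max_payoff S u p < 0 \<longrightarrow> (\<forall>(l, t)\<in>contracts S. a l t = 0))"

definition measure_support :: "real measure \<Rightarrow> real set" where
  "measure_support D = {x. \<forall>e>0. emeasure D (ball x e) > 0}"

text \<open>The lowest end-point is \<open>-\<infinity>\<close> if the support is unbounded below.\<close>

definition lowest_endpoint :: "'w measure \<Rightarrow> ('w \<Rightarrow> real) \<Rightarrow> ereal" where
  "lowest_endpoint M X = Inf (ereal ` measure_support (distr M borel X))"

definition guaranteed_profit :: "'i station \<Rightarrow> 'w measure \<Rightarrow> (nat \<Rightarrow> nat \<Rightarrow> 'w \<Rightarrow> real) \<Rightarrow> ereal" where
  "guaranteed_profit S M U =
     max (Max ((\<lambda>(i, j). lowest_endpoint M (U i j) - contract_cost S i j + base_cost S)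
                 ` contracts S)) 0"

definition pricing_strategy ::
  "'i station \<Rightarrow> 'w measure \<Rightarrow> (nat \<Rightarrow> nat \<Rightarrow> 'w \<Rightarrow> real) \<Rightarrow> nat \<Rightarrow> nat \<Rightarrow> ereal" where
  "pricing_strategy S M U l t = contract_cost S l t - base_cost S + guaranteed_profit S M U"

end

theory Submission
  imports Defs
begin

text \<open>
  The strategy charges every contract its marginal cost \<open>v\<^bsub>l,t\<^esub> - v\<^bsub>-k\<^esub>\<close> plus one and the same markup
  \<open>G \<ge> 0\<close>. A choice \<open>a\<close> of total weight \<open>s\<close> therefore earns the station exactly \<open>G * s\<close>, and its
  social welfare is the surplus of the user plus \<open>G * s\<close>
  (\<open>profit_constant_markup\<close>, \<open>welfare_constant_markup\<close>). The markup does not distort the choice between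
  two contracts; it can only distort the choice between charging and leaving.

  If the user charges, then \<open>s = 1\<close>, so both summands of the welfare are as large as they can be among
  all choices of contracts of finite cost, and weight on contracts of infinite cost only
  lowers the welfare (\<open>welfare_le_without_unservable\<close>).

  If the user leaves, every contract has negative payoff. This is impossible for \<open>G > 0\<close>: then \<open>G\<close> is
  attained as the lowest endpoint minus the marginal cost of some contract, and the utility of that
  contract is at least the lowest endpoint, so the contract is acceptable. Hence \<open>G = 0\<close>, no contract
  has positive welfare, and leaving is optimal; the profit is \<open>0 = G\<close>.

  The prices are nonnegative because marginal costs are: a plan that serves the arriving user can be
  turned into a plan of equal cost that does not (\<open>base_cost_le_contract_cost\<close>).
\<close>

section \<open>Costs\<close>

text \<open>
  The energy meant for the arriving user is discarded instead. Then the battery levels and the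
  conventional energy bought, hence also the cost, stay the same.
\<close>

lemma base_cost_le_contract_cost:
  "base_cost S \<le> contract_cost S l d"
  unfolding contract_cost_def
proof (rule INF_greatest)
  fix x assume "x \<in> {x. feasible_plan S x \<and> real l \<le> (\<Sum>t = arrival S..<d. r_new x t + q_new x t)}"
  then have x: "feasible_plan S x" by simp
  define y where "y = x\<lparr>r_new := (\<lambda>_. 0), q_new := (\<lambda>_. 0),
    r_tot := (\<lambda>t. r_tot x t - r_new x t), discard := (\<lambda>t. discard x t + r_new x t + q_new x t)\<rparr>"
  have rate: "0 \<le> max_rate S" if "t \<in> {arrival S..<horizon S}" for t
  proof -
    have "0 \<le> r_new x t" "0 \<le> q_new x t" "r_new x t + q_new x t \<le> max_rate S"
      using x that unfolding feasible_plan_def by blast+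
    then show ?thesis by linarith
  qed
  have r_tot: "r_tot x t - r_new x t = (\<Sum>i\<in>present S. r_old x i t)"
    if "t \<in> {arrival S..<horizon S}" for t
  proof -
    have "r_new x t + (\<Sum>i\<in>present S. r_old x i t) = r_tot x t"
      using x that unfolding feasible_plan_def by blast
    then show ?thesis by linarith
  qed
  have r_tot_nonneg: "0 \<le> r_tot x t - r_new x t" if "t \<in> {arrival S..<horizon S}" for t
  proof -
    have "0 \<le> r_old x i t" if "i \<in> present S" for i
      using x \<open>t \<in> _\<close> that unfolding feasible_plan_def by blast
    then show ?thesis
      unfolding r_tot[OF that] by (rule sum_nonneg)
  qed
  have q_tot: "(\<Sum>i\<in>present S. q_old x i t) \<le> q_tot x t"
    if "t \<in> {arrival S..<horizon S}" for t
  proof -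
    have "0 \<le> q_new x t" "q_new x t + (\<Sum>i\<in>present S. q_old x i t) \<le> q_tot x t"
      using x that unfolding feasible_plan_def by blast+
    then show ?thesis by linarith
  qed
  have unchanged: "r_old y = r_old x" "q_old y = q_old x" "q_tot y = q_tot x" "battery y = battery x"
    by (simp_all add: y_def)
  have changed: "r_new y t = 0" "q_new y t = 0" "r_tot y t = r_tot x t - r_new x t"
    "discard y t = discard x t + r_new x t + q_new x t" for t
    by (simp_all add: y_def)
  note feasible = x[unfolded feasible_plan_def]
  have "feasible_plan S y"
    unfolding feasible_plan_def unchanged changed
  proof (intro conjI ballI)
    fix t assume t: "t \<in> {arrival S..<horizon S}"
    have "0 \<le> discard x t" "0 \<le> r_new x t" "0 \<le> q_new x t"
      using feasible t by blast+
    then show "0 \<le> discard x t + r_new x t + q_new x t"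
      by linarith
    have "battery x (t + 1) = battery x t + harvest S t - r_tot x t + q_tot x t
          - q_new x t - (\<Sum>i\<in>present S. q_old x i t) - discard x t"
      using feasible t by blast
    then show "battery x (t + 1) = battery x t + harvest S t - (r_tot x t - r_new x t) + q_tot x t
          - 0 - (\<Sum>i\<in>present S. q_old x i t) - (discard x t + r_new x t + q_new x t)"
      by linarith
    show "0 \<le> r_tot x t - r_new x t"
      using t by (rule r_tot_nonneg)
    show "0 + 0 \<le> max_rate S"
      using rate[OF t] by simp
    show "0 + (\<Sum>i\<in>present S. r_old x i t) = r_tot x t - r_new x t"
      using r_tot[OF t] by simp
    show "0 + (\<Sum>i\<in>present S. q_old x i t) \<le> q_tot x t"
      using q_tot[OF t] by simp
  qed (use feasible in \<open>blast intro: order_refl\<close>)+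
  moreover have "plan_cost S y = plan_cost S x"
    by (simp add: plan_cost_def y_def)
  ultimately show "base_cost S \<le> ereal (plan_cost S x)"
    unfolding base_cost_def by (intro INF_lower2[of y]) (auto simp: y_def)
qed

lemma finite_contracts: "finite (contracts S)"
  by (simp add: contracts_def)

lemma contracts_nonempty: "valid_station S \<Longrightarrow> contracts S \<noteq> {}"
  by (auto simp: contracts_def valid_station_def)

section \<open>Marginal cost plus a constant markup\<close>

text \<open>
  The next two facts are identities between sums in \<^typ>\<open>ereal\<close>; they hold term by term because an
  admissible choice puts no weight on contracts of infinite cost, where the differences are not
  meaningful.
\<close>

lemma profit_constant_markup:
  assumes b: "base_cost S = ereal b"
    and p: "\<And>l t. (l, t) \<in> contracts S \<Longrightarrow> p l t = contract_cost S l t - ereal b + ereal g"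
    and a: "admissible_choice S p a"
  shows "profit S p a = ereal (g * (\<Sum>(l, t)\<in>contracts S. a l t))"
proof -
  have "(p l t - contract_cost S l t + base_cost S) * ereal (a l t) = ereal (g * a l t)"
    if lt: "(l, t) \<in> contracts S" for l t
  proof -
    have "contract_cost S l t \<noteq> -\<infinity>"
      using base_cost_le_contract_cost[of S l t] b by auto
    moreover have "a l t = 0" if "contract_cost S l t = \<infinity>"
      using a lt p[OF lt] that unfolding admissible_choice_def by auto
    ultimately show ?thesis
      by (cases "contract_cost S l t") (auto simp: p[OF lt] b)
  qed
  then have "profit S p a = (\<Sum>(l, t)\<in>contracts S. ereal (g * a l t))"
    unfolding profit_def by (intro sum.cong) auto
  then show ?thesis
    by (simp add: case_prod_unfold sum_distrib_left)
qed

lemma welfare_constant_markup: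
  assumes b: "base_cost S = ereal b"
    and p: "\<And>l t. (l, t) \<in> contracts S \<Longrightarrow> p l t = contract_cost S l t - ereal b + ereal g"
    and a: "admissible_choice S p a"
  shows "social_welfare S u a =
    user_surplus S u p a + ereal (g * (\<Sum>(l, t)\<in>contracts S. a l t))"
proof -
  have "(ereal (u l t) - contract_cost S l t + base_cost S) * ereal (a l t)
      = ereal (a l t) * (ereal (u l t) - p l t) + ereal (g * a l t)"
    if lt: "(l, t) \<in> contracts S" for l t
  proof -
    have "contract_cost S l t \<noteq> -\<infinity>"
      using base_cost_le_contract_cost[of S l t] b by auto
    moreover have "a l t = 0" if "contract_cost S l t = \<infinity>"
      using a lt p[OF lt] that unfolding admissible_choice_def by auto
    ultimately show ?thesis
      by (cases "contract_cost S l t") (auto simp: p[OF lt] b algebra_simps)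
  qed
  then have "social_welfare S u a =
      (\<Sum>(l, t)\<in>contracts S. ereal (a l t) * (ereal (u l t) - p l t) + ereal (g * a l t))"
    unfolding social_welfare_def by (intro sum.cong) auto
  then show ?thesis
    by (simp add: user_surplus_def case_prod_unfold sum.distrib sum_distrib_left)
qed

text \<open>
  Under other price menus the user may buy a contract that cannot be served. Such a purchase
  contributes \<open>-\<infinity>\<close> to the welfare, so it is enough to compare with choices that avoid these contracts.
\<close>

lemma welfare_le_without_unservable:
  assumes b: "base_cost S = ereal b"
    and a: "admissible_choice S p a"
  shows "social_welfare S u a
    \<le> social_welfare S u (\<lambda>l t. if contract_cost S l t = \<infinity> then 0 else a l t)"
  unfolding social_welfare_def
proof (rule sum_mono, clarify)
  fix l t assume "(l, t) \<in> contracts S"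
  then have "0 \<le> a l t" using a unfolding admissible_choice_def by auto
  then show "(ereal (u l t) - contract_cost S l t + base_cost S) * ereal (a l t)
    \<le> (ereal (u l t) - contract_cost S l t + base_cost S)
       * ereal (if contract_cost S l t = \<infinity> then 0 else a l t)"
    by (auto simp: b)
qed

lemma admissible_without_unservable:
  assumes p: "\<And>l t. (l, t) \<in> contracts S \<Longrightarrow> p l t = contract_cost S l t - ereal b + ereal g"
    and a: "admissible_choice S p' a"
  shows "admissible_choice S p (\<lambda>l t. if contract_cost S l t = \<infinity> then 0 else a l t)"
proof -
  have "(\<Sum>(l, t)\<in>contracts S. if contract_cost S l t = \<infinity> then 0 else a l t)
      \<le> (\<Sum>(l, t)\<in>contracts S. a l t)"
    using a unfolding admissible_choice_def by (intro sum_mono) auto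
  moreover have "contract_cost S l t = \<infinity>" if "(l, t) \<in> contracts S" "p l t = \<infinity>" for l t
    using p[OF that(1)] that(2) by (cases "contract_cost S l t") auto
  ultimately show ?thesis
    using a unfolding admissible_choice_def by fastforce
qed

section \<open>The response of the user\<close>

text \<open>
  A user who charges puts total weight one on the contracts, the largest weight possible, and
  maximizes the surplus; by \<open>welfare_constant_markup\<close> this maximizes the welfare.
\<close>

lemma charging_maximizes_welfare:
  assumes b: "base_cost S = ereal b" and g: "0 \<le> g"
    and p: "\<And>l t. (l, t) \<in> contracts S \<Longrightarrow> p l t = contract_cost S l t - ereal b + ereal g"
    and a: "user_response S u p a" and charge: "(\<Sum>(l, t)\<in>contracts S. a l t) = 1"
    and a': "admissible_choice S p' a'"
  shows "social_welfare S u a' \<le> social_welfare S u a"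
proof -
  have adm_a: "admissible_choice S p a"
    and optimal: "\<forall>a'. admissible_choice S p a' \<longrightarrow> user_surplus S u p a' \<le> user_surplus S u p a"
    using a by (simp_all add: user_response_def)
  define a'' where "a'' = (\<lambda>l t. if contract_cost S l t = \<infinity> then 0 else a' l t)"
  have adm: "admissible_choice S p a''"
    unfolding a''_def using admissible_without_unservable p a' by blast
  have "social_welfare S u a' \<le> social_welfare S u a''"
    unfolding a''_def using welfare_le_without_unservable b a' by blast
  also have "\<dots> = user_surplus S u p a'' + ereal (g * (\<Sum>(l, t)\<in>contracts S. a'' l t))"
    using b p adm by (rule welfare_constant_markup)
  also have "\<dots> \<le> user_surplus S u p a + ereal (g * 1)"
  proof (rule add_mono)
    show "user_surplus S u p a'' \<le> user_surplus S u p a"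
      using optimal adm by simp
    have "(\<Sum>(l, t)\<in>contracts S. a'' l t) \<le> 1"
      using adm by (simp add: admissible_choice_def)
    then have "g * (\<Sum>(l, t)\<in>contracts S. a'' l t) \<le> g * 1"
      using g by (rule mult_left_mono)
    then show "ereal (g * (\<Sum>(l, t)\<in>contracts S. a'' l t)) \<le> ereal (g * 1)"
      by simp
  qed
  also have "\<dots> = social_welfare S u a"
    using welfare_constant_markup[OF b p adm_a, of u] charge by simp
  finally show ?thesis .
qed

lemma welfare_nonpos:
  assumes "\<And>l t. (l, t) \<in> contracts S \<Longrightarrow> ereal (u l t) - contract_cost S l t + base_cost S \<le> 0"
    and "admissible_choice S p a"
  shows "social_welfare S u a \<le> 0"
  unfolding social_welfare_def
proof (rule sum_nonpos, clarify)
  fix l t assume lt: "(l, t) \<in> contracts S"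
  have "ereal (a l t) \<ge> 0" using lt assms(2) unfolding admissible_choice_def by auto
  with assms(1)[OF lt]
  show "(ereal (u l t) - contract_cost S l t + base_cost S) * ereal (a l t) \<le> 0"
    by (simp add: ereal_mult_le_0_iff)
qed

text \<open>
  With a positive markup the contract at which the maximum in \<^const>\<open>guaranteed_profit\<close> is attained has
  nonnegative payoff for every realization. So a user who leaves reveals that the markup is zero,
  and then payoff and welfare of a contract coincide.
\<close>

lemma leaving_user:
  assumes S: "valid_station S" and b: "base_cost S = ereal b"
    and G: "guaranteed_profit S M U = ereal g"
    and p: "\<And>l t. (l, t) \<in> contracts S \<Longrightarrow> p l t = contract_cost S l t - ereal b + ereal g"
    and low: "\<And>l t. (l, t) \<in> contracts S \<Longrightarrow> lowest_endpoint M (U l t) \<le> ereal (u l t)"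
    and leave: "max_payoff S u p < 0"
  shows "g = 0"
    and "(l, t) \<in> contracts S \<Longrightarrow> ereal (u l t) - contract_cost S l t + base_cost S \<le> 0"
proof -
  have neg: "ereal (u l t) - p l t < 0" if "(l, t) \<in> contracts S" for l t
    using leave that contracts_nonempty[OF S] finite_contracts[of S]
    unfolding max_payoff_def by (subst (asm) Max_less_iff) auto
  have below: "ereal (u l t) - contract_cost S l t + base_cost S < ereal g"
    if lt: "(l, t) \<in> contracts S" for l t
  proof -
    have "contract_cost S l t \<noteq> -\<infinity>"
      using base_cost_le_contract_cost[of S l t] b by auto
    then show ?thesis
      using neg[OF lt] by (cases "contract_cost S l t") (auto simp: p[OF lt] b)
  qed
  have "lowest_endpoint M (U l t) - contract_cost S l t + base_cost S < ereal g"
    if lt: "(l, t) \<in> contracts S" for l t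
  proof -
    have "lowest_endpoint M (U l t) - contract_cost S l t + base_cost S
        \<le> ereal (u l t) - contract_cost S l t + base_cost S"
      by (intro add_right_mono ereal_minus_mono low lt order_refl)
    then show ?thesis using below[OF lt] by simp
  qed
  then have "Max ((\<lambda>(i, j). lowest_endpoint M (U i j) - contract_cost S i j + base_cost S)
      ` contracts S) < ereal g"
    using contracts_nonempty[OF S] finite_contracts[of S] by (subst Max_less_iff) auto
  then show g: "g = 0"
    using G unfolding guaranteed_profit_def max_def by (auto simp: zero_ereal_def split: if_splits)
  show "ereal (u l t) - contract_cost S l t + base_cost S \<le> 0" if "(l, t) \<in> contracts S"
    using below[OF that] g by (simp add: zero_ereal_def)
qed

lemma guaranteed_profit_nonneg: "0 \<le> guaranteed_profit S M U"
  by (simp add: guaranteed_profit_def)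

text \<open>
  The utilities are real, hence the lowest endpoints are less than \<open>\<infinity>\<close>. They may be \<open>-\<infinity>\<close>, and costs
  may be \<open>\<infinity>\<close>, but both only push the maximum down, and the positive part is at least zero.
\<close>

lemma guaranteed_profit_finite:
  assumes S: "valid_station S" and b: "base_cost S = ereal b"
    and low: "\<And>l t. (l, t) \<in> contracts S \<Longrightarrow> lowest_endpoint M (U l t) \<le> ereal (u l t)"
  shows "guaranteed_profit S M U < \<infinity>"
proof -
  have "lowest_endpoint M (U l t) - contract_cost S l t + base_cost S < \<infinity>"
    if lt: "(l, t) \<in> contracts S" for l t
  proof -
    have "contract_cost S l t \<noteq> -\<infinity>"
      using base_cost_le_contract_cost[of S l t] b by auto
    then show ?thesis
      using low[OF lt] b
      by (cases "contract_cost S l t"; cases "lowest_endpoint M (U l t)") auto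
  qed
  then have "Max ((\<lambda>(i, j). lowest_endpoint M (U i j) - contract_cost S i j + base_cost S)
      ` contracts S) < \<infinity>"
    using contracts_nonempty[OF S] finite_contracts[of S] by (subst Max_less_iff) auto
  then show ?thesis by (simp add: guaranteed_profit_def max_def)
qed

lemma price_menu_pricing_strategy:
  assumes "\<bar>base_cost S\<bar> \<noteq> \<infinity>"
  shows "price_menu S (pricing_strategy S M U)"
  using assms base_cost_le_contract_cost[of S] guaranteed_profit_nonneg[of S M U]
  unfolding price_menu_def pricing_strategy_def
  by (auto intro!: add_nonneg_nonneg ereal_diff_positive)

section \<open>Optimality of the strategy\<close>

theorem theorem4:
  fixes S :: "'i station"
    and M :: "'w measure"
    and U :: "nat \<Rightarrow> nat \<Rightarrow> 'w \<Rightarrow> real"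
    and A :: "'w \<Rightarrow> (nat \<Rightarrow> nat \<Rightarrow> ereal) \<Rightarrow> nat \<Rightarrow> nat \<Rightarrow> real"
  assumes "valid_station S"
    and "\<bar>base_cost S\<bar> \<noteq> \<infinity>"
    and "prob_space M"
    and "\<And>l t. (l, t) \<in> contracts S \<Longrightarrow> U l t \<in> borel_measurable M"
    and "\<And>l t \<omega>. (l, t) \<in> contracts S \<Longrightarrow> \<omega> \<in> space M \<Longrightarrow>
           lowest_endpoint M (U l t) \<le> ereal (U l t \<omega>)"
    and "\<And>\<omega> p. \<omega> \<in> space M \<Longrightarrow> price_menu S p \<Longrightarrow>
           user_response S (\<lambda>l t. U l t \<omega>) p (A \<omega> p)"
  shows "price_menu S (pricing_strategy S M U) \<and>
    (\<forall>\<omega>\<in>space M.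
       (\<forall>p. price_menu S p \<longrightarrow>
          social_welfare S (\<lambda>l t. U l t \<omega>) (A \<omega> p)
            \<le> social_welfare S (\<lambda>l t. U l t \<omega>) (A \<omega> (pricing_strategy S M U))) \<and>
       profit S (pricing_strategy S M U) (A \<omega> (pricing_strategy S M U))
         = guaranteed_profit S M U)"
proof (intro conjI ballI)
  show menu: "price_menu S (pricing_strategy S M U)"
    using assms(2) by (rule price_menu_pricing_strategy)
  obtain b where b: "base_cost S = ereal b"
    using assms(2) by auto
  fix \<omega> assume \<omega>: "\<omega> \<in> space M"
  define u where "u = (\<lambda>l t. U l t \<omega>)"
  define p where "p = pricing_strategy S M U"
  define a where "a = A \<omega> p"
  have low: "lowest_endpoint M (U l t) \<le> ereal (u l t)" if "(l, t) \<in> contracts S" for l t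
    using assms(5)[OF that \<omega>] by (simp add: u_def)
  obtain g where G: "guaranteed_profit S M U = ereal g" and g: "0 \<le> g"
    using guaranteed_profit_finite[OF assms(1) b low] guaranteed_profit_nonneg[of S M U]
    by (cases "guaranteed_profit S M U") auto
  have p: "p l t = contract_cost S l t - ereal b + ereal g" if "(l, t) \<in> contracts S" for l t
    by (simp add: p_def pricing_strategy_def b G)
  have resp: "user_response S u p a"
    using assms(6)[OF \<omega> menu] by (simp add: u_def p_def a_def)
  then have adm: "admissible_choice S p a"
    by (simp add: user_response_def)
  have other: "admissible_choice S p' (A \<omega> p')" if "price_menu S p'" for p'
    using assms(6)[OF \<omega> that] by (simp add: user_response_def)
  have "(\<forall>p'. price_menu S p' \<longrightarrow> social_welfare S u (A \<omega> p') \<le> social_welfare S u a) \<and>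
    profit S p a = ereal g"
  proof (cases "max_payoff S u p < 0")
    case False
    then have charge: "(\<Sum>(l, t)\<in>contracts S. a l t) = 1"
      using resp unfolding user_response_def by simp
    moreover have "social_welfare S u (A \<omega> p') \<le> social_welfare S u a" if "price_menu S p'" for p'
      using b g p resp charge other[OF that] by (rule charging_maximizes_welfare)
    ultimately show ?thesis
      using profit_constant_markup[OF b p adm] by simp
  next
    case True
    then have zero: "\<forall>(l, t)\<in>contracts S. a l t = 0"
      using resp unfolding user_response_def by simp
    have "social_welfare S u a = 0"
      unfolding social_welfare_def using zero by (intro sum.neutral) auto
    moreover have "profit S p a = 0"
      unfolding profit_def using zero by (intro sum.neutral) auto
    moreover have "g = 0"
      using leaving_user(1)[OF assms(1) b G p low True] .
    moreover have "social_welfare S u (A \<omega> p') \<le> 0" if "price_menu S p'" for p'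
      using leaving_user(2)[OF assms(1) b G p low True] other[OF that] by (rule welfare_nonpos)
    ultimately show ?thesis by simp
  qed
  then show "\<forall>p. price_menu S p \<longrightarrow> social_welfare S (\<lambda>l t. U l t \<omega>) (A \<omega> p)
      \<le> social_welfare S (\<lambda>l t. U l t \<omega>) (A \<omega> (pricing_strategy S M U))"
    and "profit S (pricing_strategy S M U) (A \<omega> (pricing_strategy S M U))
      = guaranteed_profit S M U"
    by (simp_all add: u_def p_def a_def G)
qed

end
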